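(* Let $H_N=(h_{i,j})\in\mathbb{C}^{N\times N}$ be an upper Hessenberg matrix with positive real subdiagonal entries $h_{j+1,j}>0$ ($1\le j\le N-1$), let $q_0,\dots,q_{N-1}$ be the associated polynomials, let $\delta\in\mathbb{C}$, and let $$\sigma_k(z):=\sqrt{\sum_{j=0}^k|q_j(z)|^2}.$$ For $1\le k\le N-1$ let $Q_{k+1}(\delta)\in\mathbb{C}^{(k+1)\times(k+1)}$ be the unitary factor in the QR-decomposition of $\underline{H}_k-\delta\underline{I}_k$ built from the Givens parameters $c_j(\delta),s_j(\delta)$ (as specified in the context). Then the entries of $Q_{k+1}(\delta)^*$ are as follows. For $1\le i\le k$ and $1\le j\le k+1$, $$\bigl(Q_{k+1}(\delta)^*\bigr)_{i,j}=\begin{cases}-\dfrac{q_{j-1}(\delta)\,\overline{q_i(\delta)}}{\sigma_i(\delta)\,\sigma_{i-1}(\delta)} & \text{if } j\le i,\\[2ex] \dfrac{\sigma_{i-1}(\delta)}{\sigma_i(\delta)} & \text{if } j=i+1,\\[2ex] 0 & \text{if } j>i+1,\end{cases}$$ and for the last row, for $1\le j\le k+1$, $$\bigl(Q_{k+1}(\delta)^*\bigr)_{k+1,j}=(-1)^k\,\frac{q_{j-1}(\delta)}{\sigma_k(\delta)}.$$ Moreover, for $k\ge 1$ (with $k\le N-1$), $$s_k(\delta)=\frac{\sigma_{k-1}(\delta)}{\sigma_k(\delta)}\qquad\text{and}\qquad c_k(\delta)=(-1)^k\frac{q_k(\delta)}{\sigma_k(\delta)}.$$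
   Context: Polynomials: $q_0(z)=1$ and, for $1\le k\le N-1$, $q_k$ is defined recursively by $h_{k+1,k}\,q_k(z)=z\,q_{k-1}(z)-\sum_{j=1}^k h_{j,k}\,q_{j-1}(z)$. Matrices: $H_k$ denotes the leading $k\times k$ principal submatrix of $H_N$; $\underline{I}_k\in\mathbb{C}^{(k+1)\times k}$ consists of the first $k$ columns of $I_{k+1}$; $\underline{H}_k=H_{k+1}\underline{I}_k\in\mathbb{C}^{(k+1)\times k}$ (that is, $H_k$ with the extra last row $h_{k+1,k}\mathbf{e}_k^*$). $\cdot^*$ denotes the conjugate transpose. QR factor: $Q_1(\delta)=[1]$ and, for $1\le k\le N-1$, $$Q_{k+1}(\delta)^*=\Omega_{k+1}(\delta)\begin{bmatrix}Q_k(\delta)^*&0\\0&1\end{bmatrix},\qquad \Omega_{k+1}(\delta)=\begin{bmatrix}I_{k-1}&0&0\\0&\overline{c_k(\delta)}&s_k(\delta)\\0&-s_k(\delta)&c_k(\delta)\end{bmatrix},$$ where $c_k(\delta)\in\mathbb{C}$, $s_k(\delta)\ge 0$, $s_k(\delta)^2+|c_k(\delta)|^2=1$ are the (unique) parameters such that $$Q_{k+1}(\delta)^*(\underline{H}_k-\delta\underline{I}_k)=\begin{bmatrix}R_k(\delta)\\0\end{bmatrix}$$ with $R_k(\delta)\in\mathbb{C}^{k\times k}$ upper triangular with positive real diagonal entries. In particular $Q_{k+1}(\delta)$ is unitary with determinant $1$. *)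

theory Defs
  imports
    "HOL-Analysis.Analysis"
    "HOL-Computational_Algebra.Polynomial"
    "Jordan_Normal_Form.Schur_Decomposition"
begin

text \<open>Matrix entries are 0-indexed here: the mathematical entry \<open>h\<^sub>i\<^sub>,\<^sub>j\<close> is \<open>H $$ (i - 1, j - 1)\<close>.
  The indices of the polynomials, of \<open>\<sigma>\<close>, of the Givens parameters and of the unitary factors, as
  well as the matrix sizes, are the mathematical ones.\<close>

definition upper_hessenberg :: "'a::zero mat \<Rightarrow> bool" where
  "upper_hessenberg A \<longleftrightarrow> (\<forall>i < dim_row A. \<forall>j < dim_col A. j + 1 < i \<longrightarrow> A $$ (i, j) = 0)"

definition pos_real :: "complex \<Rightarrow> bool" where
  "pos_real z \<longleftrightarrow> z \<in> \<real> \<and> 0 < Re z"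

text \<open>The recursion for \<open>q\<^sub>k\<^sub>+\<^sub>1\<close>, solved for its left-hand side;
  only meaningful for \<open>k + 1 < dim_row H\<close>.\<close>

fun hess_poly :: "complex mat \<Rightarrow> nat \<Rightarrow> complex poly" where
  "hess_poly H 0 = 1"
| "hess_poly H (Suc k) =
     Polynomial.smult (inverse (H $$ (Suc k, k)))
       ([:0, 1:] * hess_poly H k - (\<Sum>j\<le>k. Polynomial.smult (H $$ (j, k)) (hess_poly H j)))"

definition hess_sigma :: "complex mat \<Rightarrow> nat \<Rightarrow> complex \<Rightarrow> real" where
  "hess_sigma H k z = sqrt (\<Sum>j\<le>k. (cmod (poly (hess_poly H j) z))\<^sup>2)"

definition leading_submatrix :: "'a mat \<Rightarrow> nat \<Rightarrow> 'a mat" where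
  "leading_submatrix A k = mat k k (\<lambda>(i, j). A $$ (i, j))"

definition underline_I :: "nat \<Rightarrow> complex mat" where
  "underline_I k = mat (k + 1) k (\<lambda>(i, j). 1\<^sub>m (k + 1) $$ (i, j))"

definition underline_H :: "complex mat \<Rightarrow> nat \<Rightarrow> complex mat" where
  "underline_H H k = leading_submatrix H (k + 1) * underline_I k"

text \<open>\<open>givens_mat k c s\<close> is the \<open>(k + 1) \<times> (k + 1)\<close> matrix \<open>\<Omega>\<^sub>k\<^sub>+\<^sub>1\<close>, for \<open>k \<ge> 1\<close>.\<close>

definition givens_mat :: "nat \<Rightarrow> complex \<Rightarrow> real \<Rightarrow> complex mat" where
  "givens_mat k c s = four_block_mat
     (1\<^sub>m (k - 1)) (0\<^sub>m (k - 1) 2)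
     (0\<^sub>m 2 (k - 1)) (mat_of_rows_list 2 [[cnj c, of_real s], [- of_real s, c]])"

text \<open>\<open>givens_step k Q c s\<close> is \<open>Q\<^sub>k\<^sub>+\<^sub>1\<^sup>*\<close> when \<open>Q\<close> is \<open>Q\<^sub>k\<close>.\<close>

definition givens_step :: "nat \<Rightarrow> complex mat \<Rightarrow> complex \<Rightarrow> real \<Rightarrow> complex mat" where
  "givens_step k Q c s = givens_mat k c s *
     four_block_mat (mat_adjoint Q) (0\<^sub>m k 1) (0\<^sub>m 1 k) (1\<^sub>m 1)"

definition is_givens_param ::
  "complex mat \<Rightarrow> complex \<Rightarrow> nat \<Rightarrow> complex mat \<Rightarrow> complex \<Rightarrow> real \<Rightarrow> bool" where
  "is_givens_param H \<delta> k Q c s \<longleftrightarrow>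
     0 \<le> s \<and> s\<^sup>2 + (cmod c)\<^sup>2 = 1 \<and>
     (\<exists>R \<in> carrier_mat k k. upper_triangular R \<and> (\<forall>i<k. pos_real (R $$ (i, i))) \<and>
        givens_step k Q c s * (underline_H H k - \<delta> \<cdot>\<^sub>m underline_I k) = R @\<^sub>r 0\<^sub>m 1 k)"

definition givens_param ::
  "complex mat \<Rightarrow> complex \<Rightarrow> nat \<Rightarrow> complex mat \<Rightarrow> complex \<times> real" where
  "givens_param H \<delta> k Q = (THE (c, s). is_givens_param H \<delta> k Q c s)"

text \<open>\<open>qr_Q H \<delta> k\<close> is \<open>Q\<^sub>k(\<delta>)\<close> for \<open>k \<ge> 1\<close>; the value at \<open>0\<close> is irrelevant.\<close>

fun qr_Q :: "complex mat \<Rightarrow> complex \<Rightarrow> nat \<Rightarrow> complex mat" where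
  "qr_Q H \<delta> 0 = 1\<^sub>m 0"
| "qr_Q H \<delta> (Suc 0) = 1\<^sub>m 1"
| "qr_Q H \<delta> (Suc (Suc m)) =
     (let k = Suc m; Q = qr_Q H \<delta> k; (c, s) = givens_param H \<delta> k Q
      in mat_adjoint (givens_step k Q c s))"

definition qr_c :: "complex mat \<Rightarrow> complex \<Rightarrow> nat \<Rightarrow> complex" where
  "qr_c H \<delta> k = fst (givens_param H \<delta> k (qr_Q H \<delta> k))"

definition qr_s :: "complex mat \<Rightarrow> complex \<Rightarrow> nat \<Rightarrow> real" where
  "qr_s H \<delta> k = snd (givens_param H \<delta> k (qr_Q H \<delta> k))"

end

theory Submission
  imports Defs
begin

text \<open>The recursion says that the row vector \<open>(q\<^sub>0(\<delta>), \<dots>, q\<^sub>k(\<delta>))\<close> annihilates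
  \<open>underline_H H k - \<delta> \<cdot>\<^sub>m underline_I k\<close>, so after normalisation it is the last row of
  \<open>Q\<^sub>k\<^sub>+\<^sub>1\<^sup>*\<close>. Hence, when the Givens rotation \<open>\<Omega>\<^sub>k\<^sub>+\<^sub>1\<close> is applied, the only entry to be eliminated
  is \<open>h\<^sub>k\<^sub>+\<^sub>1\<^sub>,\<^sub>k\<close> against \<open>(-1)\<^sup>k h\<^sub>k\<^sub>+\<^sub>1\<^sub>,\<^sub>k q\<^sub>k(\<delta>) / \<sigma>\<^sub>k\<^sub>-\<^sub>1(\<delta>)\<close>, which together with
  \<open>s\<^sub>k \<ge> 0\<close> and \<open>s\<^sub>k\<^sup>2 + |c\<^sub>k|\<^sup>2 = 1\<close> determines \<open>c\<^sub>k\<close> and \<open>s\<^sub>k\<close>; the entries of \<open>Q\<^sub>k\<^sub>+\<^sub>1\<^sup>*\<close>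
  follow by induction on \<open>k\<close>.\<close>

section \<open>Entrywise formulas for adjoints, Givens steps and truncated matrices\<close>

lemma dim_mat_adjoint [simp]:
  "dim_row (mat_adjoint A) = dim_col A" "dim_col (mat_adjoint A) = dim_row A"
  by (simp_all add: mat_adjoint_def)

lemma index_mat_adjoint [simp]:
  assumes "i < dim_col A" "j < dim_row A"
  shows "mat_adjoint A $$ (i, j) = conjugate (A $$ (j, i))"
  using assms by (simp add: mat_adjoint_def mat_of_rows_index)

lemma mat_adjoint_mat_adjoint [simp]: "mat_adjoint (mat_adjoint A) = A"
  by (rule eq_matI) auto

lemma index_mult_mat_sum:
  assumes "i < dim_row A" "j < dim_col B" "dim_col A = dim_row B"
  shows "(A * B) $$ (i, j) = (\<Sum>l<dim_row B. A $$ (i, l) * B $$ (l, j))"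
  using assms by (simp add: scalar_prod_def lessThan_atLeast0)

lemma dim_givens_step [simp]:
  assumes "Q \<in> carrier_mat (Suc m) (Suc m)"
  shows "dim_row (givens_step (Suc m) Q c s) = Suc (Suc m)"
    and "dim_col (givens_step (Suc m) Q c s) = Suc (Suc m)"
  using assms by (simp_all add: givens_step_def givens_mat_def mat_of_rows_list_def)

text \<open>\<open>givens_mat\<close> differs from the identity only in its last two rows and
  columns, so a step keeps the first \<open>m\<close> rows, padded by a zero, and mixes row
  \<open>m\<close> with the appended unit row.\<close>

lemma index_givens_step:
  assumes Q: "Q \<in> carrier_mat (Suc m) (Suc m)" and ij: "i < Suc (Suc m)" "j < Suc (Suc m)"
  shows "givens_step (Suc m) Q c s $$ (i, j) =
    (if i < m then (if j < Suc m then mat_adjoint Q $$ (i, j) else 0)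
     else if i = m then (if j < Suc m then cnj c * mat_adjoint Q $$ (m, j) else of_real s)
     else (if j < Suc m then - of_real s * mat_adjoint Q $$ (m, j) else c))"
proof -
  define B where "B = four_block_mat (mat_adjoint Q) (0\<^sub>m (Suc m) 1) (0\<^sub>m 1 (Suc m)) (1\<^sub>m 1)"
  define G where "G = givens_mat (Suc m) c s"
  have G_index: "G $$ (i, l) =
      (if i < m then (if l = i then 1 else 0)
       else if i = m then (if l < m then 0 else if l = m then cnj c else of_real s)
       else (if l < m then 0 else if l = m then - of_real s else c))"
    if "l < Suc (Suc m)" for l
  proof -
    have "i < m \<or> i = m \<or> i = Suc m" "l < m \<or> l = m \<or> l = Suc m"
      using that ij by linarith+
    then show ?thesis
      by (elim disjE) (simp_all add: G_def givens_mat_def mat_of_rows_list_def Suc_diff_le)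
  qed
  have B_index: "B $$ (l, j) = (if l < Suc m then (if j < Suc m then mat_adjoint Q $$ (l, j) else 0)
      else (if j < Suc m then 0 else 1))" if "l < Suc (Suc m)" for l
    using that ij Q by (auto simp: B_def)
  have dims: "dim_row G = Suc (Suc m)" "dim_col G = Suc (Suc m)"
      "dim_row B = Suc (Suc m)" "dim_col B = Suc (Suc m)"
    using Q by (simp_all add: G_def B_def givens_mat_def mat_of_rows_list_def)
  have "givens_step (Suc m) Q c s $$ (i, j) = (\<Sum>l<Suc (Suc m). G $$ (i, l) * B $$ (l, j))"
    unfolding givens_step_def G_def[symmetric] B_def[symmetric] using dims ij
    by (subst index_mult_mat_sum) simp_all
  also have "\<dots> = (\<Sum>l<m. (if l = i then B $$ (l, j) else 0)) + G $$ (i, m) * B $$ (m, j)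
      + G $$ (i, Suc m) * B $$ (Suc m, j)"
    unfolding sum.lessThan_Suc using ij
    by (intro arg_cong2[where f = "(+)"] sum.cong) (simp_all add: G_index)
  finally show ?thesis
    using ij by (auto simp: G_index B_index)
qed

lemma dim_underline [simp]:
  "dim_row (underline_I k) = Suc k" "dim_col (underline_I k) = k"
  "dim_row (underline_H H k) = Suc k" "dim_col (underline_H H k) = k"
  by (simp_all add: underline_I_def underline_H_def leading_submatrix_def)

lemma index_underline_I:
  assumes "i \<le> k" "j < k"
  shows "underline_I k $$ (i, j) = (if i = j then 1 else 0)"
  using assms by (simp add: underline_I_def)

lemma index_underline_H:
  assumes "i \<le> k" "j < k"
  shows "underline_H H k $$ (i, j) = H $$ (i, j)"
proof -
  have "underline_H H k $$ (i, j) = (\<Sum>l<Suc k. H $$ (i, l) * (if l = j then 1 else 0))"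
    unfolding underline_H_def using assms
    by (subst index_mult_mat_sum) (auto simp: leading_submatrix_def index_underline_I intro!: sum.cong)
  also have "\<dots> = H $$ (i, j)"
    using assms by (simp add: if_distrib [of "\<lambda>x. _ * x"] cong: if_cong)
  finally show ?thesis .
qed

section \<open>The polynomial values as a left null vector of the shifted matrix\<close>

locale shifted_hessenberg =
  fixes H :: "complex mat" and N :: nat and \<delta> :: complex
  assumes H_carrier: "H \<in> carrier_mat N N"
    and hessenberg: "upper_hessenberg H"
    and subdiag: "Suc j < N \<Longrightarrow> pos_real (H $$ (Suc j, j))"
begin

abbreviation q :: "nat \<Rightarrow> complex" where
  "q j \<equiv> poly (hess_poly H j) \<delta>"

abbreviation \<sigma> :: "nat \<Rightarrow> real" where
  "\<sigma> j \<equiv> hess_sigma H j \<delta>"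

text \<open>The entries of \<open>H\<close> shifted by \<delta>, free of any truncation size, so
  that sums belonging to different \<open>k\<close> can be compared directly.\<close>

definition a :: "nat \<Rightarrow> nat \<Rightarrow> complex" where
  "a i j = H $$ (i, j) - (if i = j then \<delta> else 0)"

text \<open>The candidate for the adjoint of \<open>qr_Q H \<delta> (Suc k)\<close>;
  \<open>qr_Q_eq\<close> identifies the two. Since rows count from 0, row \<open>i\<close> involves
  \<open>q (Suc i)\<close>.\<close>

definition Q_adj :: "nat \<Rightarrow> complex mat" where
  "Q_adj k = mat (Suc k) (Suc k) (\<lambda>(i, j).
     if i < k then
       (if j \<le> i then - (q j * cnj (q (Suc i)) / of_real (\<sigma> (Suc i) * \<sigma> i))
        else if j = Suc i then of_real (\<sigma> i / \<sigma> (Suc i)) else 0)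
     else (- 1) ^ k * (q j / of_real (\<sigma> k)))"

lemma dim_Q_adj [simp]: "dim_row (Q_adj k) = Suc k" "dim_col (Q_adj k) = Suc k"
  by (simp_all add: Q_adj_def)

lemma sigma_sq_Suc: "(\<sigma> (Suc k))\<^sup>2 = (\<sigma> k)\<^sup>2 + (cmod (q (Suc k)))\<^sup>2"
  \<comment> \<open>Removing \<open>hess_poly.simps(2)\<close> keeps \<open>q (Suc k)\<close> an
    atom instead of expanding it by the recursion; the same device recurs below.\<close>
  by (simp add: hess_sigma_def sum_nonneg del: hess_poly.simps(2))

lemma sigma_pos: "\<sigma> k > 0"
proof -
  have "1 = (cmod (q 0))\<^sup>2" by simp
  also have "\<dots> \<le> (\<Sum>j\<le>k. (cmod (q j))\<^sup>2)"
    by (rule member_le_sum) auto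
  finally show ?thesis by (simp add: hess_sigma_def)
qed

lemma sigma_nz [simp]: "\<sigma> k \<noteq> 0"
  using sigma_pos[of k] by simp

lemma subdiag_nz: "Suc j < N \<Longrightarrow> H $$ (Suc j, j) \<noteq> 0"
  using subdiag[of j] by (auto simp: pos_real_def)

lemma a_eq_0: "l < N \<Longrightarrow> j < N \<Longrightarrow> Suc j < l \<Longrightarrow> a l j = 0"
  using hessenberg H_carrier by (auto simp: a_def upper_hessenberg_def)

lemma a_Suc: "a (Suc j) j = H $$ (Suc j, j)"
  by (simp add: a_def)

text \<open>This is the recursion evaluated at \<delta>: the diagonal shift in \<open>a\<close>
  absorbs the term \<open>\<delta> * q j\<close>.\<close>

lemma sum_q_a_upto:
  assumes "Suc j < N"
  shows "(\<Sum>l\<le>j. q l * a l j) = - (H $$ (Suc j, j) * q (Suc j))"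
proof -
  have "H $$ (Suc j, j) * q (Suc j) = \<delta> * q j - (\<Sum>l\<le>j. H $$ (l, j) * q l)"
    using subdiag_nz[OF assms] by (simp add: poly_sum)
  moreover have "(\<Sum>l\<le>j. q l * a l j) = (\<Sum>l\<le>j. H $$ (l, j) * q l) - \<delta> * q j"
    by (simp add: a_def right_diff_distrib sum_subtractf mult.commute
        if_distrib [of "\<lambda>x. _ * x"] if_distrib [of "\<lambda>x. x * _"] cong: if_cong)
  ultimately show ?thesis by simp
qed

text \<open>By the Hessenberg shape, column \<open>j\<close> ends at row \<open>Suc j\<close>, and
  the term there cancels the partial sum up to \<open>j\<close>.\<close>

lemma sum_q_a_eq_0:
  assumes "j < i" "i < N"
  shows "(\<Sum>l\<le>i. q l * a l j) = 0"
proof -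
  have "(\<Sum>l\<le>i. q l * a l j) = (\<Sum>l\<le>Suc j. q l * a l j)"
    using assms by (intro sum.mono_neutral_right) (auto simp: a_eq_0)
  also have "\<dots> = 0"
    unfolding sum.atMost_Suc using assms by (simp add: sum_q_a_upto a_Suc del: hess_poly.simps(2))
  finally show ?thesis .
qed

lemma index_shifted:
  assumes "i \<le> k" "j < k"
  shows "(underline_H H k - \<delta> \<cdot>\<^sub>m underline_I k) $$ (i, j) = a i j"
  using assms by (simp add: index_underline_H index_underline_I a_def)

lemma index_mult_shifted:
  assumes "dim_row M = Suc k" "dim_col M = Suc k" "i \<le> k" "j < k"
  shows "(M * (underline_H H k - \<delta> \<cdot>\<^sub>m underline_I k)) $$ (i, j) = (\<Sum>l\<le>k. M $$ (i, l) * a l j)"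
proof -
  have "(M * (underline_H H k - \<delta> \<cdot>\<^sub>m underline_I k)) $$ (i, j)
    = (\<Sum>l<Suc k. M $$ (i, l) * (underline_H H k - \<delta> \<cdot>\<^sub>m underline_I k) $$ (l, j))"
    using assms by (subst index_mult_mat_sum) (simp_all del: index_minus_mat(1) sum.lessThan_Suc)
  also have "\<dots> = (\<Sum>l<Suc k. M $$ (i, l) * a l j)"
    using assms by (intro sum.cong refl) (simp add: index_shifted del: index_minus_mat(1))
  finally show ?thesis by (simp add: lessThan_Suc_atMost)
qed

section \<open>The closed form makes the shifted matrix triangular\<close>

lemma Q_adj_mult_last_row:
  assumes "k < N" "j < k"
  shows "(\<Sum>l\<le>k. Q_adj k $$ (k, l) * a l j) = 0"
proof -
  have "(\<Sum>l\<le>k. Q_adj k $$ (k, l) * a l j) = (\<Sum>l\<le>k. ((- 1) ^ k / of_real (\<sigma> k)) * (q l * a l j))"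
    by (intro sum.cong) (auto simp: Q_adj_def)
  also have "\<dots> = 0"
    unfolding sum_distrib_left[symmetric] using assms by (simp add: sum_q_a_eq_0)
  finally show ?thesis .
qed

text \<open>Row \<open>i\<close> is a multiple of the vector of \<open>q 0\<close>, ...,
  \<open>q i\<close> followed by a single further nonzero entry. Products thus reduce to partial
  sums, which vanish for \<open>j < i\<close> and stop one term short of cancelling for
  \<open>j = i\<close>.\<close>

lemma Q_adj_mult_row:
  assumes "k < N" "i < k"
  shows "(\<Sum>l\<le>k. Q_adj k $$ (i, l) * a l j) =
    - (cnj (q (Suc i)) / of_real (\<sigma> (Suc i) * \<sigma> i)) * (\<Sum>l\<le>i. q l * a l j)
    + of_real (\<sigma> i / \<sigma> (Suc i)) * a (Suc i) j"
proof -
  have "(\<Sum>l\<le>k. Q_adj k $$ (i, l) * a l j) = (\<Sum>l\<le>Suc i. Q_adj k $$ (i, l) * a l j)"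
    using assms by (intro sum.mono_neutral_right) (auto simp: Q_adj_def)
  also have "\<dots> = (\<Sum>l\<le>i. - (cnj (q (Suc i)) / of_real (\<sigma> (Suc i) * \<sigma> i)) * (q l * a l j))
      + of_real (\<sigma> i / \<sigma> (Suc i)) * a (Suc i) j"
    unfolding sum.atMost_Suc using assms
    by (intro arg_cong2[where f = "(+)"] sum.cong) (auto simp: Q_adj_def simp del: hess_poly.simps(2))
  finally show ?thesis by (simp only: sum_distrib_left)
qed

lemma Q_adj_mult_below_diag:
  assumes "k < N" "i < k" "j < i"
  shows "(\<Sum>l\<le>k. Q_adj k $$ (i, l) * a l j) = 0"
  using assms by (simp add: Q_adj_mult_row sum_q_a_eq_0 a_eq_0 del: hess_poly.simps(2))

text \<open>The uncancelled term contributes the squared modulus of \<open>q (Suc i)\<close>, which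
  adds to the square of \<open>\<sigma> i\<close> to give that of \<open>\<sigma> (Suc i)\<close>.
  The resulting value supplies the positive diagonal of the triangular factor.\<close>

lemma Q_adj_mult_diag:
  assumes "k < N" "i < k"
  shows "(\<Sum>l\<le>k. Q_adj k $$ (i, l) * a l i) = H $$ (Suc i, i) * of_real (\<sigma> (Suc i) / \<sigma> i)"
proof -
  have "(cmod (q (Suc i)))\<^sup>2 + (\<sigma> i)\<^sup>2 = (\<sigma> (Suc i))\<^sup>2"
    by (simp only: sigma_sq_Suc)
  then have eq: "q (Suc i) * cnj (q (Suc i)) + of_real ((\<sigma> i)\<^sup>2) = (of_real ((\<sigma> (Suc i))\<^sup>2) :: complex)"
    by (metis complex_norm_square of_real_add)
  have "(\<Sum>l\<le>k. Q_adj k $$ (i, l) * a l i) =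
      H $$ (Suc i, i) * (q (Suc i) * cnj (q (Suc i)) + of_real ((\<sigma> i)\<^sup>2)) / of_real (\<sigma> (Suc i) * \<sigma> i)"
    using assms unfolding Q_adj_mult_row[OF assms]
    by (simp add: sum_q_a_upto a_Suc field_simps power2_eq_square del: hess_poly.simps(2))
  also have "\<dots> = H $$ (Suc i, i) * of_real (\<sigma> (Suc i) / \<sigma> i)"
    unfolding eq by (simp add: field_simps power2_eq_square)
  finally show ?thesis .
qed

section \<open>The Givens recursion of the closed form and its parameters\<close>

lemma givens_step_Q_adj:
  "givens_step (Suc m) (mat_adjoint (Q_adj m))
     ((- 1) ^ Suc m * (q (Suc m) / of_real (\<sigma> (Suc m)))) (\<sigma> m / \<sigma> (Suc m)) = Q_adj (Suc m)"
  (is "givens_step _ ?Q ?c ?s = _")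
proof (rule eq_matI)
  have Q: "?Q \<in> carrier_mat (Suc m) (Suc m)" by (simp add: carrier_matI)
  show "dim_row (givens_step (Suc m) ?Q ?c ?s) = dim_row (Q_adj (Suc m))"
    and "dim_col (givens_step (Suc m) ?Q ?c ?s) = dim_col (Q_adj (Suc m))"
    using Q by simp_all
  fix i j assume "i < dim_row (Q_adj (Suc m))" "j < dim_col (Q_adj (Suc m))"
  then have ij: "i < Suc (Suc m)" "j < Suc (Suc m)" by simp_all
  \<comment> \<open>The last row of \<open>Q_adj m\<close> carries the sign \<open>(- 1) ^ m\<close>
    and \<open>?c\<close> carries \<open>(- 1) ^ Suc m\<close>; in the rotated row \<open>m\<close>
    a single minus sign survives.\<close>
  have sign: "(- 1) ^ m * ((- 1) ^ m * x) = (x :: complex)" for x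
    by (simp add: mult.assoc[symmetric] power_mult_distrib[symmetric])
  show "givens_step (Suc m) ?Q ?c ?s $$ (i, j) = Q_adj (Suc m) $$ (i, j)"
  proof -
    note entry = index_givens_step[OF Q ij, unfolded mat_adjoint_mat_adjoint]
    consider "i < m" | "i = m" "j \<le> m" | "i = m" "j = Suc m" | "i = Suc m" "j \<le> m"
      | "i = Suc m" "j = Suc m"
      using ij by linarith
    then show ?thesis
    proof cases
      case 1
      then show ?thesis
        unfolding entry using ij by (simp add: Q_adj_def del: hess_poly.simps(2))
    next
      case 2
      then show ?thesis
        unfolding entry by (simp add: Q_adj_def sign mult_ac del: hess_poly.simps(2))
    next
      case 3
      then show ?thesis
        unfolding entry by (simp add: Q_adj_def del: hess_poly.simps(2))
    next
      case 4
      then show ?thesis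
        unfolding entry by (simp add: Q_adj_def del: hess_poly.simps(2))
    next
      case 5
      then show ?thesis
        unfolding entry by (simp add: Q_adj_def del: hess_poly.simps(2))
    qed
  qed
qed

text \<open>The zero at the end of the last row of the product expresses \<open>c\<close> through
  \<open>s\<close>; the normalisation together with \<open>0 \<le> s\<close> then fixes
  \<open>s\<close>.\<close>

lemma givens_param_unique:
  assumes N: "Suc m < N" and P: "is_givens_param H \<delta> (Suc m) (mat_adjoint (Q_adj m)) c s"
  shows "c = (- 1) ^ Suc m * (q (Suc m) / of_real (\<sigma> (Suc m)))" and "s = \<sigma> m / \<sigma> (Suc m)"
proof -
  let ?Q = "mat_adjoint (Q_adj m)"
  let ?G = "givens_step (Suc m) ?Q c s"
  have Q: "?Q \<in> carrier_mat (Suc m) (Suc m)" by (simp add: carrier_matI)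
  from P obtain R where R: "R \<in> carrier_mat (Suc m) (Suc m)"
    and GR: "?G * (underline_H H (Suc m) - \<delta> \<cdot>\<^sub>m underline_I (Suc m)) = R @\<^sub>r 0\<^sub>m 1 (Suc m)"
    and s: "0 \<le> s" and norm: "s\<^sup>2 + (cmod c)\<^sup>2 = 1"
    unfolding is_givens_param_def by blast
  have last: "?G $$ (Suc m, l) = - (of_real s * (- 1) ^ m / of_real (\<sigma> m)) * q l" if "l \<le> m" for l
    using that by (subst index_givens_step[OF Q]) (simp_all add: Q_adj_def)
  have corner: "?G $$ (Suc m, Suc m) = c"
    by (subst index_givens_step[OF Q]) simp_all
  \<comment> \<open>Column \<open>m\<close> is the one in which the new subdiagonal entry
    \<open>H $$ (Suc m, m)\<close> has to be eliminated.\<close>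
  have "0 = (R @\<^sub>r 0\<^sub>m 1 (Suc m)) $$ (Suc m, m)"
    using R by (simp add: append_rows_def)
  also have "\<dots> = (\<Sum>l\<le>Suc m. ?G $$ (Suc m, l) * a l m)"
    unfolding GR[symmetric] using Q by (intro index_mult_shifted) simp_all
  also have "\<dots> = (\<Sum>l\<le>m. - (of_real s * (- 1) ^ m / of_real (\<sigma> m)) * (q l * a l m))
      + c * H $$ (Suc m, m)"
    unfolding sum.atMost_Suc
    by (intro arg_cong2[where f = "(+)"] sum.cong)
       (simp_all add: last corner a_Suc)
  also have "\<dots> = H $$ (Suc m, m) * (of_real s * (- 1) ^ m / of_real (\<sigma> m) * q (Suc m) + c)"
    unfolding sum_distrib_left[symmetric] sum_q_a_upto[OF N]
    by (simp add: algebra_simps del: hess_poly.simps(2))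
  finally have "of_real s * (- 1) ^ m / of_real (\<sigma> m) * q (Suc m) + c = 0"
    using subdiag_nz[OF N] by (simp del: hess_poly.simps(2))
  then have c: "c = - (of_real s * (- 1) ^ m / of_real (\<sigma> m) * q (Suc m))"
    by (metis add.commute add_eq_0_iff)
  \<comment> \<open>Taking moduli discards sign and phase, which turns the normalisation into an
    equation for \<open>s\<close> alone.\<close>
  have "cmod c = s / \<sigma> m * cmod (q (Suc m))"
    unfolding c using s sigma_pos[of m]
    by (simp add: norm_mult norm_divide norm_power del: hess_poly.simps(2))
  with norm have "s\<^sup>2 + (s / \<sigma> m * cmod (q (Suc m)))\<^sup>2 = 1" by simp
  then have "s\<^sup>2 * ((\<sigma> m)\<^sup>2 + (cmod (q (Suc m)))\<^sup>2) = (\<sigma> m)\<^sup>2"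
    by (simp add: field_simps power_mult_distrib del: hess_poly.simps(2))
  then have "(s * \<sigma> (Suc m))\<^sup>2 = (\<sigma> m)\<^sup>2"
    by (simp only: power_mult_distrib sigma_sq_Suc)
  then have "s * \<sigma> (Suc m) = \<sigma> m"
    using s sigma_pos[of m] sigma_pos[of "Suc m"]
    by (metis mult_nonneg_nonneg less_imp_le power2_eq_iff_nonneg)
  then show s_eq: "s = \<sigma> m / \<sigma> (Suc m)"
    by (simp add: field_simps)
  show "c = (- 1) ^ Suc m * (q (Suc m) / of_real (\<sigma> (Suc m)))"
    unfolding c s_eq by (simp add: field_simps del: hess_poly.simps(2))
qed

text \<open>The existence half behind the definite description in \<open>givens_param\<close>: by
  \<open>givens_step_Q_adj\<close> the rotated matrix is again a closed form, whose product with the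
  shifted matrix is known.\<close>

lemma is_givens_param_Q_adj:
  assumes N: "Suc m < N"
  shows "is_givens_param H \<delta> (Suc m) (mat_adjoint (Q_adj m))
     ((- 1) ^ Suc m * (q (Suc m) / of_real (\<sigma> (Suc m)))) (\<sigma> m / \<sigma> (Suc m))"
proof -
  let ?k = "Suc m"
  let ?A = "underline_H H ?k - \<delta> \<cdot>\<^sub>m underline_I ?k"
  let ?P = "Q_adj ?k * ?A"
  \<comment> \<open>The last row of \<open>?P\<close> vanishes by the null vector property, so its
    first \<open>?k\<close> rows serve as the triangular factor.\<close>
  define R where "R = mat ?k ?k (\<lambda>(i, j). ?P $$ (i, j))"
  have P: "?P $$ (i, j) = (\<Sum>l\<le>?k. Q_adj ?k $$ (i, l) * a l j)" if "i \<le> ?k" "j < ?k" for i j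
    using that by (intro index_mult_shifted) simp_all
  have R_carrier: "R \<in> carrier_mat ?k ?k"
    by (simp add: R_def)
  have "upper_triangular R"
    using N by (auto simp: R_def P Q_adj_mult_below_diag simp del: index_mult_mat sum.atMost_Suc)
  moreover have "pos_real (R $$ (i, i))" if "i < ?k" for i
    using that N subdiag[of i] sigma_pos[of i] sigma_pos[of "Suc i"]
    by (auto simp: R_def P Q_adj_mult_diag pos_real_def complex_is_Real_iff
        simp del: index_mult_mat sum.atMost_Suc)
  moreover have "?P = R @\<^sub>r 0\<^sub>m 1 ?k"
    using N R_carrier
    by (intro eq_matI)
       (auto simp: append_rows_def R_def P Q_adj_mult_last_row less_Suc_eq
          simp del: index_mult_mat(1) sum.atMost_Suc)
  moreover have "(\<sigma> m / \<sigma> ?k)\<^sup>2 + (cmod ((- 1) ^ ?k * (q ?k / of_real (\<sigma> ?k))))\<^sup>2 = 1"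
  proof -
    have "(\<sigma> m / \<sigma> ?k)\<^sup>2 + (cmod ((- 1) ^ ?k * (q ?k / of_real (\<sigma> ?k))))\<^sup>2
        = ((\<sigma> m)\<^sup>2 + (cmod (q ?k))\<^sup>2) / (\<sigma> ?k)\<^sup>2"
      by (simp add: norm_mult norm_divide norm_power power_divide add_divide_distrib
          del: hess_poly.simps(2))
    also have "\<dots> = 1"
      by (simp add: sigma_sq_Suc[symmetric] del: hess_poly.simps(2))
    finally show ?thesis .
  qed
  ultimately show ?thesis
    unfolding is_givens_param_def givens_step_Q_adj
    using R_carrier sigma_pos[of m] sigma_pos[of ?k] by (auto intro!: bexI[of _ R])
qed

lemma givens_param_Q_adj:
  assumes "Suc m < N"
  shows "givens_param H \<delta> (Suc m) (mat_adjoint (Q_adj m)) =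
    ((- 1) ^ Suc m * (q (Suc m) / of_real (\<sigma> (Suc m))), \<sigma> m / \<sigma> (Suc m))"
  unfolding givens_param_def
proof (rule the_equality)
  fix p :: "complex \<times> real"
  assume "case p of (c, s) \<Rightarrow> is_givens_param H \<delta> (Suc m) (mat_adjoint (Q_adj m)) c s"
  then show "p = ((- 1) ^ Suc m * (q (Suc m) / of_real (\<sigma> (Suc m))), \<sigma> m / \<sigma> (Suc m))"
    unfolding case_prod_beta using givens_param_unique[OF assms]
    by (intro prod_eqI) (simp_all only: fst_conv snd_conv)
qed (simp only: case_prod_conv is_givens_param_Q_adj[OF assms])

text \<open>Each closed form determines the next Givens parameters, and the step with these
  parameters yields the next closed form. The start uses that \<open>q 0\<close> and
  \<open>\<sigma> 0\<close> are both 1.\<close>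

lemma qr_Q_eq: "k < N \<Longrightarrow> qr_Q H \<delta> (Suc k) = mat_adjoint (Q_adj k)"
proof (induction k)
  case 0
  show ?case
    by (rule eq_matI) (auto simp: Q_adj_def hess_sigma_def)
next
  case (Suc m)
  then show ?case
    by (simp only: qr_Q.simps Suc_lessD givens_param_Q_adj givens_step_Q_adj Let_def case_prod_conv)
qed

end

section \<open>Translation to one-based indices\<close>

theorem proposition2p2:
  fixes H :: "complex mat" and N k :: nat and \<delta> :: complex
  assumes "H \<in> carrier_mat N N"
    and "upper_hessenberg H"
    and "\<And>j. 1 \<le> j \<Longrightarrow> j < N \<Longrightarrow> pos_real (H $$ (j, j - 1))"
    and "1 \<le> k" and "k < N"
  shows "let q = (\<lambda>j. poly (hess_poly H j) \<delta>);
             \<sigma> = (\<lambda>j. hess_sigma H j \<delta>);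
             Q_adj = mat_adjoint (qr_Q H \<delta> (k + 1))
         in (\<forall>i \<in> {1..k}. \<forall>j \<in> {1..k + 1}.
               Q_adj $$ (i - 1, j - 1) =
                 (if j \<le> i then - (q (j - 1) * cnj (q i) / of_real (\<sigma> i * \<sigma> (i - 1)))
                  else if j = i + 1 then of_real (\<sigma> (i - 1) / \<sigma> i)
                  else 0))
          \<and> (\<forall>j \<in> {1..k + 1}.
               Q_adj $$ (k, j - 1) = (- 1) ^ k * (q (j - 1) / of_real (\<sigma> k)))
          \<and> qr_s H \<delta> k = \<sigma> (k - 1) / \<sigma> k
          \<and> qr_c H \<delta> k = (- 1) ^ k * (q k / of_real (\<sigma> k))"
proof -
  \<comment> \<open>The theorem numbers subdiagonal entries by row from 1, the locale by column from
    0; hence the instance at \<open>Suc _\<close>.\<close>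
  interpret shifted_hessenberg H N \<delta>
    using assms(1,2) assms(3)[of "Suc _"] by unfold_locales auto
  \<comment> \<open>The parameters of index \<open>k\<close> arise in the step that starts from
    \<open>Q_adj m\<close>, one index lower.\<close>
  obtain m where k: "k = Suc m"
    using \<open>1 \<le> k\<close> by (cases k) auto
  have Q: "mat_adjoint (qr_Q H \<delta> (k + 1)) = Q_adj k"
    using \<open>k < N\<close> by (simp only: Suc_eq_plus1[symmetric] qr_Q_eq mat_adjoint_mat_adjoint)
  have cs: "givens_param H \<delta> k (qr_Q H \<delta> k) = ((- 1) ^ k * (q k / of_real (\<sigma> k)), \<sigma> m / \<sigma> k)"
    using \<open>k < N\<close> unfolding k by (simp only: qr_Q_eq Suc_lessD givens_param_Q_adj)
  have "Q_adj k $$ (i - 1, j - 1) =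
      (if j \<le> i then - (q (j - 1) * cnj (q i) / of_real (\<sigma> i * \<sigma> (i - 1)))
       else if j = i + 1 then of_real (\<sigma> (i - 1) / \<sigma> i) else 0)"
    if "i \<in> {1..k}" "j \<in> {1..k + 1}" for i j
    using that by (cases i; cases j) (auto simp: Q_adj_def simp del: hess_poly.simps(2))
  moreover have "Q_adj k $$ (k, j - 1) = (- 1) ^ k * (q (j - 1) / of_real (\<sigma> k))"
    if "j \<in> {1..k + 1}" for j
    using that by (auto simp: Q_adj_def)
  ultimately show ?thesis
    unfolding Let_def Q qr_s_def qr_c_def cs by (simp add: k del: hess_poly.simps(2))
qed

end
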